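(* Let $x\in[0,1)$ and let $x=\sum_{i=1}^{\infty}2^{-i}d_i$, with each $d_i\in\{0,1\}$, be a base 2 expansion of $x$ that does not end in all ones (i.e. there is no $N$ such that $d_i=1$ for all $i\ge N$). For $n\ge 1$ let $p_n=\sum_{i=1}^{n}d_i$. Then $$\lim_{n\to\infty}\left(\frac1n\sum_{i=0}^{n-1}\{2^i x\}-\frac{p_n}{n}\right)=0 .$$
   Context: Here $\{y\}=y-\lfloor y\rfloor$ denotes the usual fractional part of a real number $y$; thus $\{2^i x\}=T^i(x)$, where $T:[0,1)\to[0,1)$ is the angle doubling map $T(x)=2x \bmod 1$. *)

theory Defs
  imports Complex_Main
begin

end

theory Submission
  imports Defs
begin

text \<open>
  The difference telescopes. The orbit point \<open>t\<^sub>i = {2\<^sup>i x}\<close> is the number whose binary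
  digits are \<open>d\<^sub>i\<^sub>+\<^sub>1, d\<^sub>i\<^sub>+\<^sub>2, \<dots>\<close> (lemma \<open>frac_power2_mult_eq_binary_tail\<close>), so doubling it splits
  off one digit: \<open>2 t\<^sub>i = d\<^sub>i\<^sub>+\<^sub>1 + t\<^sub>i\<^sub>+\<^sub>1\<close>, which can be read as
  \<open>t\<^sub>i = d\<^sub>i\<^sub>+\<^sub>1 + (t\<^sub>i\<^sub>+\<^sub>1 - t\<^sub>i)\<close>. Summing over \<open>i < n\<close> gives
  \<open>\<Sum>t\<^sub>i - p\<^sub>n = t\<^sub>n - t\<^sub>0\<close>, which is bounded by 1 in absolute value, and dividing by \<open>n\<close> gives the
  limit. The identification of \<open>t\<^sub>i\<close> with a fractional part is the only place where the digits
  must not end in all ones: such an expansion would have a tail equal to 1 instead of 0.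
\<close>

definition binary_tail :: "(nat \<Rightarrow> nat) \<Rightarrow> nat \<Rightarrow> real" where
  "binary_tail d i = (\<Sum>k. real (d (Suc (i + k))) / 2 ^ Suc k)"

lemma summable_binary_tail:
  assumes "\<And>i. i \<ge> 1 \<Longrightarrow> d i \<le> 1"
  shows "summable (\<lambda>k. real (d (Suc (i + k))) / 2 ^ Suc k)"
proof (rule summable_comparison_test')
  show "summable (\<lambda>k. (1 / 2 :: real) ^ Suc k)"
    using power_half_series sums_summable by blast
  show "norm (real (d (Suc (i + k))) / 2 ^ Suc k) \<le> (1 / 2) ^ Suc k" if "k \<ge> 0" for k
    using assms[of "Suc (i + k)"] by (simp add: power_divide divide_right_mono)
qed

lemma binary_tail_nonneg:
  assumes "\<And>i. i \<ge> 1 \<Longrightarrow> d i \<le> 1"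
  shows "0 \<le> binary_tail d i"
  unfolding binary_tail_def by (intro suminf_nonneg summable_binary_tail assms) auto

lemma binary_tail_le_1:
  assumes "\<And>i. i \<ge> 1 \<Longrightarrow> d i \<le> 1"
  shows "binary_tail d i \<le> 1"
proof -
  have "binary_tail d i \<le> (\<Sum>k. (1 / 2 :: real) ^ Suc k)"
    unfolding binary_tail_def
  proof (rule suminf_le)
    show "real (d (Suc (i + k))) / 2 ^ Suc k \<le> (1 / 2) ^ Suc k" for k
      using assms[of "Suc (i + k)"] by (simp add: power_divide divide_right_mono)
    show "summable (\<lambda>k. real (d (Suc (i + k))) / 2 ^ Suc k)"
      by (rule summable_binary_tail[OF assms])
    show "summable (\<lambda>k. (1 / 2 :: real) ^ Suc k)"
      using power_half_series sums_summable by blast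
  qed
  also have "\<dots> = 1"
    using power_half_series sums_unique by fastforce
  finally show ?thesis .
qed

text \<open>Doubling a binary number shifts its leading digit in front of the binary point.\<close>

lemma double_binary_tail:
  assumes "\<And>i. i \<ge> 1 \<Longrightarrow> d i \<le> 1"
  shows "2 * binary_tail d i = real (d (Suc i)) + binary_tail d (Suc i)"
proof -
  have "(\<Sum>k. real (d (Suc (i + Suc k))) / 2 ^ Suc (Suc k)) = binary_tail d i - real (d (Suc i)) / 2"
    using suminf_split_head[OF summable_binary_tail[of d i, OF assms]]
    by (simp add: binary_tail_def)
  moreover have "(\<Sum>k. real (d (Suc (i + Suc k))) / 2 ^ Suc (Suc k)) = binary_tail d (Suc i) / 2"
    using suminf_divide[OF summable_binary_tail[of d "Suc i", OF assms], of 2]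
    by (simp add: binary_tail_def mult.commute)
  ultimately show ?thesis
    by simp
qed

text \<open>
  A tail equal to 1 forces its leading digit and the next tail to be 1 too, because neither
  can exceed 1 and they add up to 2. Hence it forces all later digits to be 1.
\<close>

lemma binary_tail_less_1:
  assumes "\<And>i. i \<ge> 1 \<Longrightarrow> d i \<le> 1"
    and "\<not> (\<exists>N. \<forall>i\<ge>N. d i = 1)"
  shows "binary_tail d i < 1"
proof (rule ccontr)
  assume "\<not> binary_tail d i < 1"
  then have start: "binary_tail d i = 1"
    using binary_tail_le_1[of d i, OF assms(1)] by simp
  have step: "d (Suc j) = 1 \<and> binary_tail d (Suc j) = 1" if "binary_tail d j = 1" for j
  proof -
    have "real (d (Suc j)) + binary_tail d (Suc j) = 2"
      using double_binary_tail[of d j, OF assms(1)] that by simp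
    moreover have "real (d (Suc j)) \<le> 1"
      using assms(1)[of "Suc j"] by simp
    moreover have "binary_tail d (Suc j) \<le> 1"
      by (rule binary_tail_le_1[OF assms(1)])
    ultimately show ?thesis
      by linarith
  qed
  have tail: "binary_tail d j = 1" if "j \<ge> i" for j
    using that by (induction j rule: dec_induct) (use start step in auto)
  have "d j = 1" if "j \<ge> Suc i" for j
    using that step[OF tail, of "j - 1"] by simp
  with assms(2) show False
    by blast
qed

lemma frac_power2_mult_eq_binary_tail:
  assumes "\<And>i. i \<ge> 1 \<Longrightarrow> d i \<le> 1"
    and "\<not> (\<exists>N. \<forall>i\<ge>N. d i = 1)"
    and "(\<lambda>i. real (d (Suc i)) / 2 ^ Suc i) sums x"
  shows "frac (2 ^ i * x) = binary_tail d i"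
proof -
  have "2 ^ i * x - binary_tail d i \<in> \<int>"
  proof (induction i)
    case 0
    then show ?case
      using sums_unique[OF assms(3)] by (simp add: binary_tail_def)
  next
    case (Suc i)
    have "2 ^ Suc i * x - binary_tail d (Suc i) =
        2 * (2 ^ i * x - binary_tail d i) + real (d (Suc i))"
      using double_binary_tail[of d i, OF assms(1)] by (simp add: algebra_simps)
    also have "\<dots> \<in> \<int>"
      using Suc.IH by (intro Ints_add Ints_mult) auto
    finally show ?case .
  qed
  then show ?thesis
    using binary_tail_nonneg[of d i, OF assms(1)] binary_tail_less_1[of d i, OF assms(1,2)]
    by (simp add: frac_unique_iff)
qed

theorem lemma1p1:
  fixes x :: real and d :: "nat \<Rightarrow> nat"
  assumes "x \<in> {0..<1}"
    and "\<And>i. i \<ge> 1 \<Longrightarrow> d i \<in> {0, 1}"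
    and "(\<lambda>i. real (d (Suc i)) / 2 ^ Suc i) sums x"
    and "\<not> (\<exists>N. \<forall>i\<ge>N. d i = 1)"
  shows "(\<lambda>n. (1 / real n) * (\<Sum>i=0..<n. frac (2 ^ i * x)) - real (\<Sum>i=1..n. d i) / real n) \<longlonglongrightarrow> 0"
proof -
  have digit: "d i \<le> 1" if "i \<ge> 1" for i
    using assms(2)[OF that] by auto
  have telescope: "(\<Sum>i=0..<n. frac (2 ^ i * x)) - real (\<Sum>i=1..n. d i)
      = binary_tail d n - binary_tail d 0" for n
  proof (induction n)
    case (Suc n)
    then show ?case
      using double_binary_tail[of d n, OF digit]
      by (simp add: frac_power2_mult_eq_binary_tail[OF digit assms(4,3)])
  qed simp
  show ?thesis
  proof (rule tendsto_0_le)
    show "(\<lambda>n. 1 / real n) \<longlonglongrightarrow> 0"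
      by (rule lim_1_over_n)
    have "\<bar>binary_tail d n - binary_tail d 0\<bar> \<le> 1" for n
      using binary_tail_nonneg[of d n, OF digit] binary_tail_nonneg[of d 0, OF digit]
        binary_tail_le_1[of d n, OF digit] binary_tail_le_1[of d 0, OF digit]
      by linarith
    moreover have "(1 / real n) * (\<Sum>i=0..<n. frac (2 ^ i * x)) - real (\<Sum>i=1..n. d i) / real n
        = (binary_tail d n - binary_tail d 0) / real n" for n
      unfolding telescope[symmetric] by (simp add: diff_divide_distrib)
    ultimately show "\<forall>\<^sub>F n in sequentially. norm ((1 / real n) * (\<Sum>i=0..<n. frac (2 ^ i * x))
        - real (\<Sum>i=1..n. d i) / real n) \<le> norm (1 / real n) * 1"
      by (simp add: divide_right_mono)
  qed
qed

end
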